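(* Let $d \ge 1$. There do not exist an integer $k \ge 2$, pairwise distinct Cartesian subgroups $\Lambda_1, \dots, \Lambda_k$ of $\mathbf{Z}^d$, and vectors $v_1, \dots, v_k \in \mathbf{Z}^d$ such that the cosets $v_1 + \Lambda_1, \dots, v_k + \Lambda_k$ are pairwise disjoint and their union is $\mathbf{Z}^d$.
   Context: A subgroup of $\mathbf{Z}^d$ is called Cartesian if it has the form $\prod_{i=1}^d a_i \mathbf{Z} = a_1\mathbf{Z} \times \cdots \times a_d \mathbf{Z}$ for some positive integers $a_1, \dots, a_d$. *)

theory Defs
  imports "HOL-Analysis.Finite_Cartesian_Product" "HOL-Library.Disjoint_Sets"
begin

definition cartesian_subgroup :: "(int ^ 'd::finite) set \<Rightarrow> bool" where
  "cartesian_subgroup \<Lambda> \<longleftrightarrow>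
     (\<exists>a :: 'd \<Rightarrow> int. (\<forall>i. a i > 0) \<and> \<Lambda> = {x. \<forall>i. x $ i \<in> range (\<lambda>m :: int. a i * m)})"

definition coset :: "int ^ 'd::finite \<Rightarrow> (int ^ 'd) set \<Rightarrow> (int ^ 'd) set" where
  "coset v \<Lambda> = (\<lambda>x. v + x) ` \<Lambda>"

end

theory Submission
  imports Defs
begin

text \<open>
  Among the cosets of a tiling choose one, with moduli \<open>a\<^sub>1, \<dots>, a\<^sub>d\<close>, whose index
  \<open>a\<^sub>1 \<cdots> a\<^sub>d\<close> is largest, and sum the character
  \<open>x \<mapsto> exp (2 \<pi> i (x\<^sub>1 / a\<^sub>1 + \<dots> + x\<^sub>d / a\<^sub>d))\<close> over a large cube whose side is a common
  multiple of all moduli. A coset with moduli \<open>b\<^sub>1, \<dots>, b\<^sub>d\<close> contributes \<open>0\<close> unless every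
  \<open>a\<^sub>i\<close> divides \<open>b\<^sub>i\<close>, which by maximality forces \<open>b = a\<close>; the total over the cube is \<open>0\<close> since
  the character is nontrivial. As the subgroups are distinct, the chosen coset is the only one
  left, but its contribution is not \<open>0\<close>, because the character is constant on it.
\<close>

text \<open>For \<open>a > 0\<close> this is the additive character of the integers modulo
  \<open>a\<close> that sends 1 to a primitive \<open>a\<close>-th root of unity.\<close>

definition root_char :: "int \<Rightarrow> int \<Rightarrow> complex" where
  "root_char a t = cis (2 * pi * (of_int t / of_int a))"

lemma root_char_add: "root_char a (s + t) = root_char a s * root_char a t"
  by (simp add: root_char_def cis_mult ring_distribs add_divide_distrib)

lemma root_char_eq_1_iff:
  assumes "a \<noteq> 0"
  shows "root_char a t = 1 \<longleftrightarrow> a dvd t"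
proof
  assume "root_char a t = 1"
  then have "cos (2 * pi * (of_int t / of_int a)) = 1"
    by (simp add: root_char_def complex_eq_iff)
  then obtain n :: int where "2 * pi * (of_int t / of_int a) = of_int n * 2 * pi"
    using cos_one_2pi_int by blast
  then have "real_of_int t = of_int (n * a)"
    using assms by (simp add: field_simps)
  then have "t = n * a"
    by (simp only: of_int_eq_iff)
  then show "a dvd t" by simp
next
  assume "a dvd t"
  then show "root_char a t = 1"
    using assms cis_multiple_2pi[OF Ints_of_int]
    by (auto simp: root_char_def mult.assoc elim!: dvdE)
qed

lemma root_char_eqI:
  assumes "a \<noteq> 0" "a dvd s - t"
  shows "root_char a s = root_char a t"
  using root_char_add[of a "s - t" t] root_char_eq_1_iff[of a "s - t"] assms by simp

abbreviation residue_class :: "int \<Rightarrow> int \<Rightarrow> int \<Rightarrow> int set" where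
  "residue_class N b v \<equiv> {t \<in> {0..<N}. b dvd t - v}"

lemma finite_residue_class: "finite (residue_class N b v)"
  by (rule finite_Collect_conjI) simp

lemma dvd_mod_diff_iff:
  fixes b N s v :: int
  assumes "b dvd N"
  shows "b dvd s mod N - v \<longleftrightarrow> b dvd s - v"
  using assms by (metis mod_eq_dvd_iff mod_mod_cancel)

text \<open>Translation by \<open>b\<close> followed by reduction modulo \<open>N\<close> permutes
  the residue class because \<open>b\<close> divides \<open>N\<close>, and the reduction leaves
  \<open>root_char a\<close> unchanged because \<open>a\<close> divides \<open>N\<close>. So the sum
  equals \<open>root_char a b\<close> times itself, and that factor is not 1 when \<open>a\<close>
  does not divide \<open>b\<close>.\<close>

lemma sum_root_char_residue_class_eq_0:
  assumes "N > 0" "a \<noteq> 0" "a dvd N" "b dvd N" "\<not> a dvd b"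
  shows "sum (root_char a) (residue_class N b v) = 0"
proof -
  let ?S = "sum (root_char a) (residue_class N b v)"
  have "(\<Sum>t\<in>residue_class N b v. root_char a (b + t)) = ?S"
  proof (rule sum.reindex_bij_witness[of _ "\<lambda>t. (t - b) mod N" "\<lambda>t. (b + t) mod N"])
    fix t assume t: "t \<in> residue_class N b v"
    show "((b + t) mod N - b) mod N = t"
      using t by (simp add: mod_simps)
    show "(b + (t - b) mod N) mod N = t"
      using t by (simp add: mod_simps)
    have "b dvd (b + t) - v" "b dvd (t - b) - v"
      using t dvd_add[of b b "t - v"] dvd_diff[of b "t - v" b] by (simp_all add: algebra_simps)
    then show "(b + t) mod N \<in> residue_class N b v" "(t - b) mod N \<in> residue_class N b v"
      using assms by (simp_all add: dvd_mod_diff_iff)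
    have "a dvd (b + t) mod N - (b + t)"
      using assms(3) by (simp add: dvd_mod_diff_iff)
    then show "root_char a ((b + t) mod N) = root_char a (b + t)"
      by (intro root_char_eqI assms)
  qed
  then have "root_char a b * ?S = ?S"
    by (simp add: root_char_add sum_distrib_left)
  then have "(root_char a b - 1) * ?S = 0"
    by (simp add: algebra_simps)
  with assms show ?thesis
    by (simp add: root_char_eq_1_iff)
qed

text \<open>On a class modulo \<open>a\<close> the character is constant, so the sum is the size of
  the class times a root of unity; the class is nonempty as it contains
  \<open>v mod N\<close>.\<close>

lemma sum_root_char_residue_class_neq_0:
  assumes "N > 0" "a \<noteq> 0" "a dvd N"
  shows "sum (root_char a) (residue_class N a v) \<noteq> 0"
proof -
  have "sum (root_char a) (residue_class N a v) = (\<Sum>t\<in>residue_class N a v. root_char a v)"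
    using assms by (intro sum.cong refl root_char_eqI) auto
  also have "\<dots> = of_nat (card (residue_class N a v)) * root_char a v"
    by simp
  also have "\<dots> \<noteq> 0"
  proof -
    have "v mod N \<in> residue_class N a v"
      using assms by (simp add: dvd_mod_diff_iff)
    then have "card (residue_class N a v) \<noteq> 0"
      using card_0_eq[OF finite_residue_class, of N a v] by blast
    then show ?thesis
      by (simp add: root_char_def)
  qed
  finally show ?thesis .
qed

text \<open>Distributivity over a product set; it reduces the sums of the multidimensional character
  to one-dimensional sums, one for each coordinate.\<close>

lemma sum_prod_vec:
  fixes f :: "'d::finite \<Rightarrow> 'a \<Rightarrow> 'b::comm_semiring_1"
  assumes "\<And>i. finite (T i)"
  shows "(\<Sum>x\<in>{x::'a ^ 'd. \<forall>i. x $ i \<in> T i}. \<Prod>i\<in>UNIV. f i (x $ i)) = (\<Prod>i\<in>UNIV. sum (f i) (T i))"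
proof -
  have "(\<Prod>i\<in>UNIV. sum (f i) (T i)) = (\<Sum>g\<in>PiE UNIV T. \<Prod>i\<in>UNIV. f i (g i))"
    by (rule prod_sum_PiE) (use assms in auto)
  also have "\<dots> = (\<Sum>x\<in>{x::'a ^ 'd. \<forall>i. x $ i \<in> T i}. \<Prod>i\<in>UNIV. f i (x $ i))"
    by (rule sum.reindex_bij_witness[of _ vec_nth vec_lambda]) auto
  finally show ?thesis by simp
qed

lemma mem_coset_multiples_iff:
  fixes x v :: "int ^ 'd::finite"
  shows "x \<in> coset v {x. \<forall>i. x $ i \<in> range (\<lambda>m::int. a i * m)} \<longleftrightarrow> (\<forall>i. a i dvd x $ i - v $ i)"
proof -
  have "x \<in> coset v L \<longleftrightarrow> x - v \<in> L" for L :: "(int ^ 'd) set"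
    unfolding coset_def by (auto intro: image_eqI[of _ _ "x - v"])
  then show ?thesis by (auto simp: dvd_def image_iff)
qed

text \<open>Divisibility between positive integers gives \<open>a i \<le> b i\<close> everywhere, so
  a single strict inequality would make the product of \<open>b\<close> strictly larger.\<close>

lemma eq_if_dvd_if_prod_le:
  fixes a b :: "'d::finite \<Rightarrow> int"
  assumes pos: "\<And>i. a i > 0" "\<And>i. b i > 0" and dvd: "\<And>i. a i dvd b i"
    and le: "(\<Prod>i\<in>UNIV. b i) \<le> (\<Prod>i\<in>UNIV. a i)"
  shows "a = b"
proof (rule ccontr)
  assume "a \<noteq> b"
  then obtain i where "a i \<noteq> b i" by auto
  have le': "a j \<le> b j" for j
    using dvd pos by (simp add: zdvd_imp_le)
  then have "(\<Prod>i\<in>UNIV. a i) < (\<Prod>i\<in>UNIV. b i)"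
    using \<open>a i \<noteq> b i\<close> pos by (intro prod_mono_strict[of i]) (auto simp: less_le)
  with le show False by simp
qed

theorem mainTheorem1:
  "\<not> (\<exists>(k :: nat) (\<Lambda> :: nat \<Rightarrow> (int ^ 'd::finite) set) (v :: nat \<Rightarrow> int ^ 'd).
        k \<ge> 2 \<and>
        (\<forall>j\<in>{1..k}. cartesian_subgroup (\<Lambda> j)) \<and>
        inj_on \<Lambda> {1..k} \<and>
        disjoint_family_on (\<lambda>j. coset (v j) (\<Lambda> j)) {1..k} \<and>
        (\<Union>j\<in>{1..k}. coset (v j) (\<Lambda> j)) = UNIV)"
proof (rule notI, elim exE conjE)
  fix k :: nat and \<Lambda> :: "nat \<Rightarrow> (int ^ 'd) set" and v :: "nat \<Rightarrow> int ^ 'd"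
  assume k: "k \<ge> 2" and cart: "\<forall>j\<in>{1..k}. cartesian_subgroup (\<Lambda> j)"
    and inj: "inj_on \<Lambda> {1..k}"
    and disj: "disjoint_family_on (\<lambda>j. coset (v j) (\<Lambda> j)) {1..k}"
    and cover: "(\<Union>j\<in>{1..k}. coset (v j) (\<Lambda> j)) = UNIV"
  obtain a :: "nat \<Rightarrow> 'd \<Rightarrow> int" where
    pos: "\<And>j i. j \<in> {1..k} \<Longrightarrow> a j i > 0" and
    \<Lambda>: "\<And>j. j \<in> {1..k} \<Longrightarrow> \<Lambda> j = {x. \<forall>i. x $ i \<in> range (\<lambda>m::int. a j i * m)}"
  proof -
    have "\<exists>a. \<forall>j\<in>{1..k}. (\<forall>i. a j i > 0) \<and>
        \<Lambda> j = {x. \<forall>i. x $ i \<in> range (\<lambda>m::int. a j i * m)}"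
      using cart unfolding cartesian_subgroup_def by (rule bchoice)
    then show ?thesis using that by blast
  qed
  have a_inj: "j = l" if "j \<in> {1..k}" "l \<in> {1..k}" "a j = a l" for j l
    using inj_onD[OF inj _ that(1,2)] \<Lambda>[OF that(1)] \<Lambda>[OF that(2)] that(3) by simp
  define vol where "vol j = (\<Prod>i\<in>UNIV. a j i)" for j
  obtain m where m: "m \<in> {1..k}" and m_max: "\<And>j. j \<in> {1..k} \<Longrightarrow> vol j \<le> vol m"
  proof -
    have "Max (vol ` {1..k}) \<in> vol ` {1..k}"
      using k by (intro Max_in) auto
    then obtain m where "m \<in> {1..k}" "vol m = Max (vol ` {1..k})" by auto
    then show ?thesis using that by simp
  qed
  \<comment> \<open>Any positive common multiple of all the moduli would serve: the box then
    consists of whole periods of every coset and of the character.\<close>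
  define N where "N = (\<Prod>j\<in>{1..k}. vol j)"
  have N: "N > 0"
    unfolding N_def vol_def using pos by (intro prod_pos) auto
  have dvd_N: "a j i dvd N" if "j \<in> {1..k}" for j i
  proof -
    have "a j i dvd vol j"
      unfolding vol_def by (rule dvd_prodI) auto
    also have "vol j dvd N"
      unfolding N_def by (rule dvd_prodI) (use that in auto)
    finally show ?thesis .
  qed
  define \<psi> where "\<psi> x = (\<Prod>i\<in>UNIV. root_char (a m i) (x $ i))" for x :: "int ^ 'd"
  define box where "box = {x :: int ^ 'd. \<forall>i. x $ i \<in> {0..<N}}"
  have am0: "a m i \<noteq> 0" for i
    using pos[OF m, of i] by simp

  have coset_sum: "sum \<psi> (box \<inter> coset (v j) (\<Lambda> j)) =
      (\<Prod>i\<in>UNIV. sum (root_char (a m i)) (residue_class N (a j i) (v j $ i)))"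
    if "j \<in> {1..k}" for j
  proof -
    have "box \<inter> coset (v j) (\<Lambda> j) = {x. \<forall>i. x $ i \<in> residue_class N (a j i) (v j $ i)}"
      by (auto simp: \<Lambda>[OF that] mem_coset_multiples_iff box_def)
    then show ?thesis
      unfolding \<psi>_def by (simp only:) (rule sum_prod_vec, rule finite_residue_class)
  qed
  have coset_sum_0: "sum \<psi> (box \<inter> coset (v j) (\<Lambda> j)) = 0" if "j \<in> {1..k} - {m}" for j
  proof -
    have j: "j \<in> {1..k}" using that by simp
    have "\<not> (\<forall>i. a m i dvd a j i)"
    proof
      assume "\<forall>i. a m i dvd a j i"
      then have "a m = a j"
        using pos[OF j] pos[OF m] m_max[OF j] unfolding vol_def
        by (intro eq_if_dvd_if_prod_le) auto
      with a_inj[OF j m] that show False by simp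
    qed
    \<comment> \<open>One coordinate where divisibility fails suffices, since its vanishing factor
      kills the whole product.\<close>
    then obtain i where "\<not> a m i dvd a j i" by auto
    then have "sum (root_char (a m i)) (residue_class N (a j i) (v j $ i)) = 0"
      by (intro sum_root_char_residue_class_eq_0 N am0 dvd_N m j)
    then show ?thesis
      unfolding coset_sum[OF j] by (intro prod_zero) auto
  qed
  have m_nonzero: "sum \<psi> (box \<inter> coset (v m) (\<Lambda> m)) \<noteq> 0"
    unfolding coset_sum[OF m]
    using sum_root_char_residue_class_neq_0[OF N am0 dvd_N[OF m]] by simp

  have box_sum: "sum \<psi> box = (\<Prod>i\<in>UNIV. sum (root_char (a m i)) {0..<N})"
    unfolding \<psi>_def box_def by (rule sum_prod_vec) simp
  obtain l where l: "l \<in> {1..k}" "l \<noteq> m"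
  proof
    show "(if m = 1 then 2 else 1) \<in> {1..k}" "(if m = 1 then 2 else 1) \<noteq> m"
      using k by auto
  qed
  \<comment> \<open>The character is nontrivial: if all moduli of the largest coset were 1,
    maximality would force those of coset \<open>l\<close> to be 1 too, against distinctness. The
    second index \<open>l\<close> comes from \<open>k \<ge> 2\<close>.\<close>
  have "\<exists>i. a m i \<noteq> 1"
  proof (rule ccontr)
    assume "\<not> ?thesis"
    then have "a m = a l"
      using m_max[OF l(1)] pos[OF l(1)] unfolding vol_def
      by (intro eq_if_dvd_if_prod_le) auto
    with a_inj[OF m l(1)] l show False by simp
  qed
  then obtain i where "a m i \<noteq> 1" by auto
  then have "\<not> a m i dvd 1"
    using pos[OF m, of i] by auto
  \<comment> \<open>The full interval is treated as the residue class of modulus 1, so the vanishing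
    lemma for classes also covers the sum over the box.\<close>
  then have "sum (root_char (a m i)) (residue_class N 1 0) = 0"
    by (intro sum_root_char_residue_class_eq_0 N am0 dvd_N m) auto
  also have "residue_class N 1 0 = {0..<N}" by auto
  finally have "sum (root_char (a m i)) {0..<N} = 0" .
  then have "sum \<psi> box = 0"
    unfolding box_sum by (intro prod_zero) auto

  have "box = vec_lambda ` (PiE UNIV (\<lambda>_. {0..<N}))"
    unfolding box_def by (auto intro!: image_eqI[of _ _ "vec_nth _"])
  then have "finite box"
    by (simp add: finite_PiE)
  have "sum \<psi> box = sum \<psi> (\<Union>j\<in>{1..k}. box \<inter> coset (v j) (\<Lambda> j))"
    using cover by (intro arg_cong[of _ _ "sum \<psi>"]) blast
  also have "\<dots> = (\<Sum>j\<in>{1..k}. sum \<psi> (box \<inter> coset (v j) (\<Lambda> j)))"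
    using disj \<open>finite box\<close> unfolding disjoint_family_on_def
    by (intro sum.UNION_disjoint) auto
  also have "\<dots> = sum \<psi> (box \<inter> coset (v m) (\<Lambda> m))"
    using m coset_sum_0 by (subst sum.remove[of _ m]) auto
  finally show False
    using m_nonzero \<open>sum \<psi> box = 0\<close> by simp
qed

end
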